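(* Let $\tilde F:=F|_{Q^3}:Q^3\to\mathbb{C}^3$ be the restriction of the holomorphic extension $F$ of the Ahern-Rudin map to the affine quadric $Q^3$, and let $t>1$. Then the map $\tilde F$ degenerates at some point of $M_t^3$ if and only if $t\ge\sqrt{(2+\sqrt{2})/3}$.
   Context: $Q^3:=\{(z_1,z_2,z_3,z_4)\in\mathbb{C}^4: z_1^2+z_2^2+z_3^2+z_4^2=1\}$ (a 3-dimensional complex manifold), and for $t>1$, $M_t^3:=\{(z_1,\dots,z_4)\in\mathbb{C}^4: |z_1|^2+|z_2|^2+|z_3|^2+|z_4|^2=t\}\cap Q^3$. The map $F:\mathbb{C}^4\to\mathbb{C}^3$ is $$F(z_1,z_2,z_3,z_4):=\bigl(z_1+iz_2,\ z_3+iz_4,\ (z_3+iz_4)(z_1-iz_2)(z_3-iz_4)^2+i(z_1+iz_2)(z_1-iz_2)^2(z_3-iz_4)\bigr).$$ It is the holomorphic extension to $\mathbb{C}^4$ of the map $f(z,w)=(z,w,w\bar z\bar w^2+iz\bar z^2\bar w)$ on $\mathbb{C}^2$, where $\mathbb{C}^2$ is identified with $\mathbb{R}^4\subset\mathbb{C}^4$ via $(z,w)\mapsto(\operatorname{Re}z,\operatorname{Im}z,\operatorname{Re}w,\operatorname{Im}w)$. Equivalently, in the linear coordinates $w_1=z_1+iz_2$, $w_2=z_1-iz_2$, $w_3=z_3+iz_4$, $w_4=z_3-iz_4$ one has $Q^3=\{w_1w_2+w_3w_4=1\}$, $M_t^3=\{|w_1|^2+|w_2|^2+|w_3|^2+|w_4|^2=2t\}\cap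 Q^3$ and $F(w_1,w_2,w_3,w_4)=(w_1,\,w_3,\,w_2w_3w_4^2+iw_1w_2^2w_4)$. The holomorphic map $\tilde F:Q^3\to\mathbb{C}^3$ between 3-dimensional complex manifolds "degenerates" at a point $p\in Q^3$ if its complex differential $d\tilde F_p:T_pQ^3\to\mathbb{C}^3$ is not invertible, i.e. its Jacobian determinant in local holomorphic coordinates on $Q^3$ vanishes at $p$. *)

theory Defs
  imports "HOL-Analysis.Analysis"
begin

definition Q3 :: "(complex^4) set" where
  "Q3 = {z. (z$1)^2 + (z$2)^2 + (z$3)^2 + (z$4)^2 = 1}"

definition M3 :: "real \<Rightarrow> (complex^4) set" where
  "M3 t = {z. (cmod (z$1))^2 + (cmod (z$2))^2 + (cmod (z$3))^2 + (cmod (z$4))^2 = t} \<inter> Q3"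

definition F :: "complex^4 \<Rightarrow> complex^3" where
  "F z = vector
     [z$1 + \<i> * z$2,
      z$3 + \<i> * z$4,
      (z$3 + \<i> * z$4) * (z$1 - \<i> * z$2) * (z$3 - \<i> * z$4)^2
        + \<i> * (z$1 + \<i> * z$2) * (z$1 - \<i> * z$2)^2 * (z$3 - \<i> * z$4)]"

definition F_tilde :: "complex^4 \<Rightarrow> complex^3" where
  "F_tilde = restrict F Q3"

definition curve_in :: "'a::real_normed_vector set \<Rightarrow> 'a \<Rightarrow> 'a \<Rightarrow> (real \<Rightarrow> 'a) \<Rightarrow> bool" where
  "curve_in S p v \<gamma> \<longleftrightarrow>
     \<gamma> 0 = p \<and> (\<forall>\<^sub>F s in nhds 0. \<gamma> s \<in> S) \<and> (\<gamma> has_vector_derivative v) (at 0)"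

text \<open>
  Tangent vectors are velocities of curves lying in the set. For a complex submanifold
  such as \<^term>\<open>Q3\<close>, every such set of velocities is a complex subspace: it is the usual
  (holomorphic) tangent space, regarded inside the ambient space.
\<close>

definition tangent_space :: "'a::real_normed_vector set \<Rightarrow> 'a \<Rightarrow> 'a set" where
  "tangent_space S p = {v. \<exists>\<gamma>. curve_in S p v \<gamma>}"

text \<open>
  The differential of a map defined on \<open>S\<close> pushes velocities forward; it depends only on
  the values of the map on \<open>S\<close>. It is meaningful on \<^term>\<open>tangent_space S p\<close> only. When the
  map is the restriction of a differentiable map, it is the restriction of the ambient
  derivative (see below); if the latter is complex linear, this is the complex differential.
\<close>

definition differential ::
  "'a::real_normed_vector set \<Rightarrow> ('a \<Rightarrow> 'b::real_normed_vector) \<Rightarrow> 'a \<Rightarrow> 'a \<Rightarrow> 'b" where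
  "differential S f p v =
     (THE w. \<forall>\<gamma>. curve_in S p v \<gamma> \<longrightarrow> ((f \<circ> \<gamma>) has_vector_derivative w) (at 0))"

definition degenerates_at ::
  "'a::real_normed_vector set \<Rightarrow> ('a \<Rightarrow> 'b::real_normed_vector) \<Rightarrow> 'a \<Rightarrow> bool" where
  "degenerates_at S f p \<longleftrightarrow> \<not> bij_betw (differential S f p) (tangent_space S p) UNIV"

lemma has_vector_derivative_eventually_eq:
  assumes d: "(g has_vector_derivative w) (at x)" and ev: "\<forall>\<^sub>F s in nhds x. g s = h s"
  shows "(h has_vector_derivative w) (at x)"
proof -
  have "\<forall>\<^sub>F s in at x. g s = h s"
    using ev by (auto simp: eventually_at_filter elim: eventually_mono)
  with d show ?thesis
    unfolding has_vector_derivative_def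
    by (rule has_derivative_transform_eventually) (use eventually_nhds_x_imp_x[OF ev] in auto)
qed

lemma differential_restrict:
  assumes "(f has_derivative f') (at p)" and "v \<in> tangent_space S p"
  shows "differential S (restrict f S) p v = f' v"
proof -
  have *: "((restrict f S \<circ> \<gamma>) has_vector_derivative f' v) (at 0)" if c: "curve_in S p v \<gamma>" for \<gamma>
  proof -
    have "((f \<circ> \<gamma>) has_derivative (f' \<circ> (\<lambda>x. x *\<^sub>R v))) (at 0)"
      using c assms(1) unfolding curve_in_def has_vector_derivative_def
      by (intro diff_chain_at) auto
    moreover have "f' \<circ> (\<lambda>x. x *\<^sub>R v) = (\<lambda>x. x *\<^sub>R f' v)"
      using assms(1) by (auto simp: has_derivative_def bounded_linear.linear linear_scale)
    ultimately have d: "((f \<circ> \<gamma>) has_vector_derivative f' v) (at 0)"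
      by (simp add: has_vector_derivative_def)
    have ev: "\<forall>\<^sub>F s in nhds 0. (f \<circ> \<gamma>) s = (restrict f S \<circ> \<gamma>) s"
      using c unfolding curve_in_def by (auto elim: eventually_mono)
    show ?thesis
      by (rule has_vector_derivative_eventually_eq[OF d ev])
  qed
  show ?thesis
    unfolding differential_def
  proof (rule the_equality)
    show "\<forall>\<gamma>. curve_in S p v \<gamma> \<longrightarrow> ((restrict f S \<circ> \<gamma>) has_vector_derivative f' v) (at 0)"
      using * by blast
    fix w assume w: "\<forall>\<gamma>. curve_in S p v \<gamma> \<longrightarrow> ((restrict f S \<circ> \<gamma>) has_vector_derivative w) (at 0)"
    obtain \<gamma> where "curve_in S p v \<gamma>" using assms(2) by (auto simp: tangent_space_def)
    then show "w = f' v" using w * vector_derivative_unique_at by blast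
  qed
qed

lemma tangent_space_Q3:
  assumes p: "p \<in> Q3"
  shows "tangent_space Q3 p = {v. p$1 * v$1 + p$2 * v$2 + p$3 * v$3 + p$4 * v$4 = 0}"
proof (intro equalityI subsetI)
  let ?q = "\<lambda>z::complex^4. (z$1)^2 + (z$2)^2 + (z$3)^2 + (z$4)^2"
  {
    fix v :: "complex^4" assume "v \<in> tangent_space Q3 p"
    then obtain \<gamma> where c: "\<gamma> 0 = p" "\<forall>\<^sub>F s in nhds 0. \<gamma> s \<in> Q3" "(\<gamma> has_vector_derivative v) (at 0)"
      by (auto simp: tangent_space_def curve_in_def)
    have d: "((\<lambda>s. \<gamma> s $ i) has_vector_derivative v $ i) (at 0)" for i
      using bounded_linear.has_vector_derivative[OF bounded_linear_vec_nth c(3)] .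
    have sq: "((\<lambda>s. (\<gamma> s $ i)^2) has_vector_derivative 2 * (p$i * v$i)) (at 0)" for i
      using has_vector_derivative_mult[OF d[of i] d[of i]] c(1)
      by (simp add: power2_eq_square algebra_simps)
    have "((\<lambda>s. ?q (\<gamma> s)) has_vector_derivative
             2 * (p$1 * v$1) + 2 * (p$2 * v$2) + 2 * (p$3 * v$3) + 2 * (p$4 * v$4)) (at 0)"
      by (intro has_vector_derivative_add sq)
    moreover have "((\<lambda>s. ?q (\<gamma> s)) has_vector_derivative 0) (at 0)"
    proof -
      have ev: "\<forall>\<^sub>F s in nhds 0. 1 = ?q (\<gamma> s)"
        using c(2) by (auto simp: Q3_def elim: eventually_mono)
      show ?thesis
        by (rule has_vector_derivative_eventually_eq[where g = "\<lambda>_. 1", OF has_vector_derivative_const ev])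
    qed
    ultimately have "2 * (p$1 * v$1) + 2 * (p$2 * v$2) + 2 * (p$3 * v$3) + 2 * (p$4 * v$4) = 0"
      by (rule vector_derivative_unique_at)
    then have "2 * (p$1 * v$1 + p$2 * v$2 + p$3 * v$3 + p$4 * v$4) = 0"
      by (simp only: distrib_left)
    then have "p$1 * v$1 + p$2 * v$2 + p$3 * v$3 + p$4 * v$4 = 0"
      by (rule mult_eq_0_iff[THEN iffD1, THEN disjE]) (simp, assumption)
    then show "v \<in> {v. p$1 * v$1 + p$2 * v$2 + p$3 * v$3 + p$4 * v$4 = 0}" by simp
  }
  {
    fix v :: "complex^4" assume "v \<in> {v. p$1 * v$1 + p$2 * v$2 + p$3 * v$3 + p$4 * v$4 = 0}"
    then have o: "p$1 * v$1 + p$2 * v$2 + p$3 * v$3 + p$4 * v$4 = 0" by simp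
    define k where "k = ?q v"
    define h where "h = (\<lambda>s::real. inverse (csqrt (1 + k * of_real s ^ 2)))"
    define \<gamma> where "\<gamma> = (\<lambda>s::real. (\<chi> i. h s * (p$i + of_real s * v$i)))"
    have h0: "h 0 = 1" by (simp add: h_def)
    have hf: "((\<lambda>z. inverse (csqrt (1 + k * z ^ 2))) has_field_derivative 0) (at (of_real 0))"
      by (auto intro!: derivative_eq_intros)
    have dh: "(h has_vector_derivative 0) (at 0)"
      unfolding h_def using has_vector_derivative_real_field[OF hf] by (simp add: o_def)
    have di: "((\<lambda>s. \<gamma> s $ i) has_vector_derivative v $ i) (at 0)" for i
    proof -
      have "((\<lambda>s::real. p$i + of_real s * v$i) has_vector_derivative v$i) (at 0)"
        by (auto intro!: derivative_eq_intros simp: has_vector_derivative_def scaleR_conv_of_real)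
      from has_vector_derivative_mult[OF dh this] show ?thesis
        by (simp add: \<gamma>_def h0)
    qed
    have "((\<lambda>s. \<gamma> s $ i \<bullet> b) has_derivative (\<lambda>x. x * (v $ i \<bullet> b))) (at 0)" for i b
      using has_derivative_inner_left[OF di[of i, unfolded has_vector_derivative_def], of b] by simp
    then have dg: "(\<gamma> has_vector_derivative v) (at 0)"
      unfolding has_vector_derivative_def
      by (subst has_derivative_componentwise_within) (auto simp: Basis_vec_def inner_axis)
    have "(\<lambda>s::real. 1 + k * of_real s ^ 2) \<midarrow>0\<rightarrow> 1 + k * of_real 0 ^ 2"
      by (intro tendsto_intros)
    then have "\<forall>\<^sub>F s::real in at 0. 1 + k * of_real s ^ 2 \<noteq> 0"
      by (rule tendsto_imp_eventually_ne) simp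
    then have "\<forall>\<^sub>F s::real in nhds 0. 1 + k * of_real s ^ 2 \<noteq> 0"
      by (simp add: eventually_nhds_conv_at)
    moreover have "\<gamma> s \<in> Q3" if "1 + k * of_real s ^ 2 \<noteq> 0" for s
    proof -
      have "?q (\<gamma> s) = (h s)^2 * (?q p + 2 * of_real s * (p$1 * v$1 + p$2 * v$2 + p$3 * v$3 + p$4 * v$4)
              + k * of_real s ^ 2)"
        unfolding k_def \<gamma>_def by (simp add: power2_eq_square algebra_simps)
      also have "\<dots> = (h s)^2 * (1 + k * of_real s ^ 2)"
        using p o by (simp add: Q3_def)
      also have "\<dots> = 1" using that by (simp add: h_def power_inverse)
      finally show ?thesis by (simp add: Q3_def)
    qed
    ultimately have "\<forall>\<^sub>F s in nhds 0. \<gamma> s \<in> Q3" by (auto elim: eventually_mono)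
    moreover have "\<gamma> 0 = p" by (simp add: \<gamma>_def h0 vec_eq_iff)
    ultimately show "v \<in> tangent_space Q3 p"
      using dg by (auto simp: tangent_space_def curve_in_def)
  }
qed

end

theory Submission imports Defs begin

text \<open>
  The quadratic form \<open>z\<^sub>1\<^sup>2 + z\<^sub>2\<^sup>2 + z\<^sub>3\<^sup>2 + z\<^sub>4\<^sup>2\<close> splits as \<open>a b + c d\<close> in the isotropic
  coordinates \<open>a = z\<^sub>1 + \<i> z\<^sub>2\<close>, \<open>b = z\<^sub>1 - \<i> z\<^sub>2\<close>, \<open>c = z\<^sub>3 + \<i> z\<^sub>4\<close>, \<open>d = z\<^sub>3 - \<i> z\<^sub>4\<close>, in which
  \<open>F\<close> is \<open>(a, c, P)\<close> with \<open>P = b c d\<^sup>2 + \<i> a b\<^sup>2 d\<close>. A tangent vector killed by the first two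
  components of the differential moves only \<open>b\<close> and \<open>d\<close>, and tangency makes it a multiple of
  \<open>(c, -a)\<close> there, which is nonzero on the quadric. So the map degenerates exactly where the
  derivative of \<open>P\<close> in this direction, \<open>J = c P\<^sub>b - a P\<^sub>d\<close>, vanishes
  (\<open>degenerates_iff_jacobian_eq_0\<close>).

  The point of the computation is that \<open>J\<close> depends only on the two products \<open>u = a b\<close> and
  \<open>v = c d\<close>, as the quadratic form \<open>v\<^sup>2 + (2 \<i> - 2) u v - \<i> u\<^sup>2\<close>. Its two roots are
  \<open>v / u = (1 - \<i>) k\<close> with \<open>k = 1 \<plusminus> 1 / \<surd>2\<close>, of moduli \<open>\<surd>2 \<plusminus> 1\<close>. Together with \<open>u + v = 1\<close> each
  root fixes \<open>u\<close> and \<open>v\<close>, and since the two moduli are reciprocal to each other, both roots lead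
  to the same value \<open>|u| + |v| = \<surd>((2 + \<surd>2) / 3)\<close> (\<open>jacobian_root_norm_sum\<close>).

  Finally \<open>2 t = |a|\<^sup>2 + |b|\<^sup>2 + |c|\<^sup>2 + |d|\<^sup>2 \<ge> 2 |u| + 2 |v|\<close>, and rescaling the two factors of
  a fixed nonzero product \<open>u = a b\<close> against each other realizes every value of
  \<open>|a|\<^sup>2 + |b|\<^sup>2\<close> from \<open>2 |u|\<close> upwards (\<open>factor_with_norm_sum_squares\<close>). Hence degenerate points
  occur on exactly those \<open>M\<^sub>t\<close> with \<open>t \<ge> |u| + |v|\<close>.
\<close>

section \<open>Isotropic coordinates on the quadric\<close>

text \<open>
  The inverse of \<open>z \<mapsto> (z\<^sub>1 + \<i> z\<^sub>2, z\<^sub>1 - \<i> z\<^sub>2, z\<^sub>3 + \<i> z\<^sub>4, z\<^sub>3 - \<i> z\<^sub>4)\<close>: the constructor takes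
  isotropic coordinates, so that points and tangent vectors can be decomposed by cases.
\<close>
definition iso_vec :: "complex \<Rightarrow> complex \<Rightarrow> complex \<Rightarrow> complex \<Rightarrow> complex^4" where
  "iso_vec a b c d = vector [(a + b) / 2, (a - b) / (2 * \<i>), (c + d) / 2, (c - d) / (2 * \<i>)]"

lemma vector_4 [simp]:
  "(vector [x, y, z, w] :: 'a::zero^4) $ 1 = x"
  "(vector [x, y, z, w] :: 'a::zero^4) $ 2 = y"
  "(vector [x, y, z, w] :: 'a::zero^4) $ 3 = z"
  "(vector [x, y, z, w] :: 'a::zero^4) $ 4 = w"
  unfolding vector_def by auto

lemma iso_vec_sum_diff [simp]:
  "iso_vec a b c d $ 1 + \<i> * iso_vec a b c d $ 2 = a"
  "iso_vec a b c d $ 1 - \<i> * iso_vec a b c d $ 2 = b"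
  "iso_vec a b c d $ 3 + \<i> * iso_vec a b c d $ 4 = c"
  "iso_vec a b c d $ 3 - \<i> * iso_vec a b c d $ 4 = d"
  by (simp_all add: iso_vec_def field_simps)

lemma iso_vec_eq_iff [simp]:
  "iso_vec a b c d = iso_vec a' b' c' d' \<longleftrightarrow> a = a' \<and> b = b' \<and> c = c' \<and> d = d'"
  by (metis iso_vec_sum_diff)

lemma iso_vec_cases:
  obtains a b c d where "z = iso_vec a b c d"
proof
  show "z = iso_vec (z$1 + \<i> * z$2) (z$1 - \<i> * z$2) (z$3 + \<i> * z$4) (z$3 - \<i> * z$4)"
    by (simp add: iso_vec_def vec_eq_iff forall_4)
qed

text \<open>
  This single computation serves twice: on the diagonal it gives the equation of the quadric,
  and off the diagonal the equation of its tangent spaces.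
\<close>
lemma iso_vec_bilinear:
  "iso_vec a b c d $ 1 * iso_vec a' b' c' d' $ 1 + iso_vec a b c d $ 2 * iso_vec a' b' c' d' $ 2
     + iso_vec a b c d $ 3 * iso_vec a' b' c' d' $ 3 + iso_vec a b c d $ 4 * iso_vec a' b' c' d' $ 4
   = (b * a' + a * b' + d * c' + c * d') / 2"
  by (simp add: iso_vec_def field_simps power2_eq_square)

lemma iso_vec_in_Q3_iff: "iso_vec a b c d \<in> Q3 \<longleftrightarrow> a * b + c * d = 1"
proof -
  have "(b * a + a * b + d * c + c * d) / 2 = a * b + c * d" by (simp add: field_simps)
  then show ?thesis
    unfolding Q3_def mem_Collect_eq power2_eq_square iso_vec_bilinear by (simp only:)
qed

text \<open>
  The parallelogram law. It is the source of the factor 2 between \<open>t\<close> and the norm square in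
  isotropic coordinates.
\<close>
lemma parallelogram_isotropic:
  "(cmod ((a + b) / 2))^2 + (cmod ((a - b) / (2 * \<i>)))^2 = ((cmod a)^2 + (cmod b)^2) / 2"
  unfolding norm_divide norm_mult power_divide power_mult_distrib cmod_power2
  by (simp add: field_simps power2_eq_square)

lemma iso_vec_in_M3_iff:
  "iso_vec a b c d \<in> M3 t \<longleftrightarrow>
     a * b + c * d = 1 \<and> (cmod a)^2 + (cmod b)^2 + (cmod c)^2 + (cmod d)^2 = 2 * t"
proof -
  have "(cmod (iso_vec a b c d $ 1))^2 + (cmod (iso_vec a b c d $ 2))^2 
      + (cmod (iso_vec a b c d $ 3))^2 + (cmod (iso_vec a b c d $ 4))^2
      = ((cmod a)^2 + (cmod b)^2 + (cmod c)^2 + (cmod d)^2) / 2"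
    using parallelogram_isotropic[of a b] parallelogram_isotropic[of c d]
    by (simp add: iso_vec_def)
  then show ?thesis
    by (auto simp: M3_def iso_vec_in_Q3_iff)
qed

lemma tangent_space_Q3_iso_vec:
  assumes "a * b + c * d = 1"
  shows "iso_vec a' b' c' d' \<in> tangent_space Q3 (iso_vec a b c d)
      \<longleftrightarrow> b * a' + a * b' + d * c' + c * d' = 0"
  using assms by (simp add: tangent_space_Q3 iso_vec_in_Q3_iff iso_vec_bilinear)

section \<open>Where the differential fails to be bijective\<close>

lemma has_derivative_vector_3:
  fixes f g h :: "'a::real_normed_vector \<Rightarrow> 'b::euclidean_space"
  assumes f: "(f has_derivative f') (at x)" and g: "(g has_derivative g') (at x)"
    and h: "(h has_derivative h') (at x)"
  shows "((\<lambda>x. vector [f x, g x, h x] :: 'b^3) has_derivative (\<lambda>v. vector [f' v, g' v, h' v])) (at x)"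
proof -
  have "((\<lambda>x. (vector [f x, g x, h x] :: 'b^3) $ i) has_derivative
      (\<lambda>v. (vector [f' v, g' v, h' v] :: 'b^3) $ i)) (at x)" for i
    using exhaust_3[of i] f g h by auto
  then have "((\<lambda>x. (vector [f x, g x, h x] :: 'b^3) $ i \<bullet> u) has_derivative
      (\<lambda>v. (vector [f' v, g' v, h' v] :: 'b^3) $ i \<bullet> u)) (at x)" for i u
    by (rule has_derivative_inner_left)
  then show ?thesis
    by (subst has_derivative_componentwise_within) (auto simp: Basis_vec_def inner_axis)
qed

lemma differential_F_tilde_iso_vec:
  assumes "iso_vec a' b' c' d' \<in> tangent_space Q3 (iso_vec a b c d)"
  shows "differential Q3 F_tilde (iso_vec a b c d) (iso_vec a' b' c' d')
    = vector [a', c', \<i> * b^2 * d * a' + (c * d^2 + 2 * \<i> * a * b * d) * b'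
        + b * d^2 * c' + (2 * b * c * d + \<i> * a * b^2) * d']"
proof -
  let ?p = "iso_vec a b c d" and ?v = "iso_vec a' b' c' d'"
  have nth: "((\<lambda>z::complex^4. z $ i) has_derivative (\<lambda>v. v $ i)) (at ?p)" for i
    by (rule bounded_linear_imp_has_derivative[OF bounded_linear_vec_nth])
  have A: "((\<lambda>z::complex^4. z$1 + \<i> * z$2) has_derivative (\<lambda>v. v$1 + \<i> * v$2)) (at ?p)"
      and B: "((\<lambda>z::complex^4. z$1 - \<i> * z$2) has_derivative (\<lambda>v. v$1 - \<i> * v$2)) (at ?p)"
      and C: "((\<lambda>z::complex^4. z$3 + \<i> * z$4) has_derivative (\<lambda>v. v$3 + \<i> * v$4)) (at ?p)"
      and D: "((\<lambda>z::complex^4. z$3 - \<i> * z$4) has_derivative (\<lambda>v. v$3 - \<i> * v$4)) (at ?p)"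
    by (intro has_derivative_add has_derivative_diff has_derivative_mult_right nth)+
  note third = has_derivative_add
      [OF has_derivative_mult[OF has_derivative_mult[OF C B] has_derivative_power[OF D, of 2]]
          has_derivative_mult[OF has_derivative_mult[OF has_derivative_mult_right[OF A, of \<i>]
            has_derivative_power[OF B, of 2]] D]]
  have "(F has_derivative (\<lambda>v. vector [v$1 + \<i> * v$2, v$3 + \<i> * v$4,
      \<i> * b^2 * d * (v$1 + \<i> * v$2) + (c * d^2 + 2 * \<i> * a * b * d) * (v$1 - \<i> * v$2)
        + b * d^2 * (v$3 + \<i> * v$4) + (2 * b * c * d + \<i> * a * b^2) * (v$3 - \<i> * v$4)])) (at ?p)"
    unfolding F_def[abs_def]
    by (rule has_derivative_vector_3[OF A C])
      (rule has_derivative_eq_rhs[OF third], simp add: algebra_simps power2_eq_square)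
  from differential_restrict[OF this assms] show ?thesis
    by (simp add: F_tilde_def)
qed

text \<open>
  On the tangent space, prescribing the image under the differential fixes \<open>da\<close> and \<open>dc\<close> and
  leaves two linear equations for \<open>(db, dd)\<close>: the tangency condition with coefficients
  \<open>(a, c)\<close>, and the third component with coefficients \<open>(P\<^sub>b, P\<^sub>d)\<close>. The determinant of this
  system is, up to sign, the polynomial below. When it vanishes, \<open>(c, -a)\<close> is a nonzero
  solution of the homogeneous system; otherwise Cramer's rule gives a unique solution.
\<close>
lemma degenerates_iff_jacobian_eq_0:
  assumes Q: "a * b + c * d = 1"
  shows "degenerates_at Q3 F_tilde (iso_vec a b c d) \<longleftrightarrow>
    (c * d)^2 + (2 * \<i> - 2) * (a * b) * (c * d) - \<i> * (a * b)^2 = 0"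
proof -
  let ?p = "iso_vec a b c d"
  let ?D = "differential Q3 F_tilde ?p" and ?T = "tangent_space Q3 ?p"
  \<comment> \<open>The partial derivatives of the third component with respect to \<open>b\<close> and \<open>d\<close>.\<close>
  define g where "g = c * d^2 + 2 * \<i> * a * b * d"
  define h where "h = 2 * b * c * d + \<i> * a * b^2"
  define J where "J = c * g - a * h"
  have J: "J = (c * d)^2 + (2 * \<i> - 2) * (a * b) * (c * d) - \<i> * (a * b)^2"
    by (simp add: J_def g_def h_def algebra_simps power2_eq_square)
  have D: "?D (iso_vec a' b' c' d')
      = vector [a', c', \<i> * b^2 * d * a' + g * b' + b * d^2 * c' + h * d']"
    if "b * a' + a * b' + d * c' + c * d' = 0" for a' b' c' d'
    using that differential_F_tilde_iso_vec[of a' b' c' d' a b c d] 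
    by (simp add: tangent_space_Q3_iso_vec[OF Q] g_def h_def)
  have "bij_betw ?D ?T UNIV \<longleftrightarrow> J \<noteq> 0"
  proof
    assume bij: "bij_betw ?D ?T UNIV"
    show "J \<noteq> 0"
    proof
      assume "J = 0"
      then have "?D (iso_vec 0 c 0 (-a)) = ?D (iso_vec 0 0 0 0)"
        by (subst (1 2) D) (simp_all add: J_def algebra_simps)
      moreover have "iso_vec 0 c 0 (-a) \<in> ?T" "iso_vec 0 0 0 0 \<in> ?T"
        by (simp_all add: tangent_space_Q3_iso_vec[OF Q])
      ultimately have "iso_vec 0 c 0 (-a) = iso_vec 0 0 0 0"
        using bij by (meson bij_betw_imp_inj_on inj_onD)
      with Q show False by simp
    qed
  next
    assume J0: "J \<noteq> 0"
    have solve: "\<exists>!(x, y). a * x + c * y = m \<and> g * x + h * y = n" for m n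
    proof -
      have "a * x + c * y = m \<and> g * x + h * y = n \<longleftrightarrow>
          (x, y) = ((c * n - h * m) / J, (g * m - a * n) / J)" for x y
      proof
        assume "a * x + c * y = m \<and> g * x + h * y = n"
        then have *: "a * x + c * y = m" "g * x + h * y = n" by auto
        have "J * x = c * n - h * m"
          by (simp add: J_def algebra_simps flip: *)
        moreover have "J * y = g * m - a * n"
          by (simp add: J_def algebra_simps flip: *)
        ultimately show "(x, y) = ((c * n - h * m) / J, (g * m - a * n) / J)"
          using J0 by (simp add: field_simps)
      next
        assume "(x, y) = ((c * n - h * m) / J, (g * m - a * n) / J)"
        then have *: "J * x = c * n - h * m" "J * y = g * m - a * n"
          using J0 by simp_all
        have "J * (a * x + c * y) = J * m"
          using * unfolding J_def by algebra
        moreover have "J * (g * x + h * y) = J * n"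
          using * unfolding J_def by algebra
        ultimately show "a * x + c * y = m \<and> g * x + h * y = n"
          using J0 by simp
      qed
      then show ?thesis by auto
    qed
    show "bij_betw ?D ?T UNIV"
    proof (rule bij_betwI')
      fix u v assume uv: "u \<in> ?T" "v \<in> ?T"
      obtain a1 b1 c1 d1 where u: "u = iso_vec a1 b1 c1 d1" by (rule iso_vec_cases)
      obtain a2 b2 c2 d2 where v: "v = iso_vec a2 b2 c2 d2" by (rule iso_vec_cases)
      have Tu: "b * a1 + a * b1 + d * c1 + c * d1 = 0" and Tv: "b * a2 + a * b2 + d * c2 + c * d2 = 0"
        using uv by (simp_all add: u v tangent_space_Q3_iso_vec[OF Q])
      show "?D u = ?D v \<longleftrightarrow> u = v"
      proof
        assume "?D u = ?D v"
        then have image_eq: "a1 = a2 \<and> c1 = c2 \<and> \<i> * b^2 * d * a1 + g * b1 + b * d^2 * c1 + h * d1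
            = \<i> * b^2 * d * a2 + g * b2 + b * d^2 * c2 + h * d2"
          unfolding u v D[OF Tu] D[OF Tv] vec_eq_iff forall_3 vector_3 .
        then have eq: "a1 = a2" "c1 = c2" by auto
        have "g * b1 + h * d1 = g * b2 + h * d2"
          using image_eq by (auto simp: algebra_simps)
        moreover have "a * b1 + c * d1 = a * b2 + c * d2"
          using Tu Tv eq(1,2) by algebra
        ultimately show "u = v"
          using eq solve[of "a * b2 + c * d2" "g * b2 + h * d2"] by (auto simp: u v)
      qed simp
    next
      fix y :: "complex^3"
      obtain b' d' where
        "a * b' + c * d' = - (b * y$1 + d * y$2)"
        "g * b' + h * d' = y$3 - \<i> * b^2 * d * y$1 - b * d^2 * y$2"
        using solve[of "- (b * y$1 + d * y$2)" "y$3 - \<i> * b^2 * d * y$1 - b * d^2 * y$2"] by auto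
      moreover from this have "b * y$1 + a * b' + d * y$2 + c * d' = 0"
        by algebra
      ultimately have "iso_vec (y$1) b' (y$2) d' \<in> ?T" "y = ?D (iso_vec (y$1) b' (y$2) d')"
        by (simp_all add: tangent_space_Q3_iso_vec[OF Q] D vec_eq_iff forall_3 algebra_simps)
      then show "\<exists>u\<in>?T. y = ?D u" by blast
    qed simp
  qed
  then show ?thesis by (simp add: degenerates_at_def J)
qed

section \<open>The products at a degenerate point\<close>

text \<open>
  The roots of \<open>r\<^sup>2 + (2 \<i> - 2) r - \<i>\<close> are \<open>1 - \<i> \<plusminus> \<surd>(-\<i>)\<close>, and \<open>\<surd>(-\<i>) = (1 - \<i>) / \<surd>2\<close>, so both
  are real multiples of \<open>1 - \<i>\<close>.
\<close>
lemma jacobian_factor: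
  fixes a b :: complex
  shows "b^2 + (2 * \<i> - 2) * a * b - \<i> * a^2
     = (b - (1 - \<i>) * of_real (1 + 1 / sqrt 2) * a) * (b - (1 - \<i>) * of_real (1 - 1 / sqrt 2) * a)"
proof -
  have "complex_of_real (sqrt 2) ^ 2 = 2" by (simp flip: of_real_power)
  then show ?thesis
    by (simp add: field_simps power2_eq_square complex_eq_iff)
qed

text \<open>
  The equation imposed on \<open>k\<close> has the two roots \<open>1 \<plusminus> 1 / \<surd>2\<close>, which makes a common treatment of
  both factors of the Jacobian possible. Modulo that equation, \<open>|1 + (1 - \<i>) k|\<^sup>2\<close> and
  \<open>(1 + \<surd>2 k)\<^sup>2\<close> are both constant multiples of \<open>k\<close>, namely \<open>6 k\<close> and \<open>(4 + 2 \<surd>2) k\<close>; their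
  quotient, which is the square of \<open>|a| + |b|\<close>, is the same for both roots.
\<close>
lemma norm_sum_ratio:
  fixes a b :: complex
  assumes "a + b = 1" and r: "b = (1 - \<i>) * of_real k * a" and k: "0 < k" "k^2 - 2 * k + 1 / 2 = 0"
  shows "cmod a + cmod b = sqrt ((2 + sqrt 2) / 3)"
proof -
  define A where "A = cmod a"
  have *: "(1 + (1 - \<i>) * of_real k) * a = 1" using assms by (simp add: algebra_simps)
  have "(cmod (1 + (1 - \<i>) * of_real k))^2 = (1 + k)^2 + k^2"
    by (simp add: cmod_power2)
  then have A: "((1 + k)^2 + k^2) * A^2 = 1"
    using arg_cong[OF *, of "\<lambda>x. (cmod x)^2"] by (simp add: norm_mult power_mult_distrib A_def)
  have "cmod (1 - \<i>) = sqrt 2" by (simp add: cmod_def)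
  then have B: "cmod b = sqrt 2 * k * A" using k by (simp add: r norm_mult A_def)
  have k2: "k^2 = 2 * k - 1 / 2" using k by simp
  have "(1 + k)^2 + k^2 = 6 * k" using k2 by (simp add: power2_eq_square algebra_simps)
  then have A': "k * A^2 = 1 / 6" using A by simp
  have "(A + cmod b)^2 = (1 + 2 * sqrt 2 * k + 2 * k^2) * A^2"
    unfolding B by (simp add: power2_eq_square algebra_simps)
  also have "\<dots> = (4 + 2 * sqrt 2) * (k * A^2)"
    unfolding k2 by (simp add: algebra_simps)
  also have "\<dots> = (2 + sqrt 2) / 3" unfolding A' by simp
  finally have "(A + cmod b)^2 = (2 + sqrt 2) / 3" .
  then show ?thesis unfolding A_def by (metis real_sqrt_unique norm_ge_zero add_nonneg_nonneg)
qed

lemma jacobian_root_norm_sum: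
  fixes a b :: complex
  assumes "a + b = 1" "b^2 + (2 * \<i> - 2) * a * b - \<i> * a^2 = 0"
  shows "cmod a + cmod b = sqrt ((2 + sqrt 2) / 3)"
proof -
  have "b = (1 - \<i>) * of_real (1 + 1 / sqrt 2) * a \<or> b = (1 - \<i>) * of_real (1 - 1 / sqrt 2) * a"
    using assms(2) unfolding jacobian_factor by simp
  then show ?thesis
  proof
    assume "b = (1 - \<i>) * of_real (1 + 1 / sqrt 2) * a"
    from assms(1) this show ?thesis
      by (rule norm_sum_ratio) (simp_all add: power2_eq_square field_simps add_pos_pos)
  next
    assume "b = (1 - \<i>) * of_real (1 - 1 / sqrt 2) * a"
    from assms(1) this show ?thesis
      by (rule norm_sum_ratio) (simp_all add: power2_eq_square field_simps)
  qed
qed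

lemma jacobian_root_exists:
  obtains a b :: complex where "a + b = 1" "a \<noteq> 0" "b^2 + (2 * \<i> - 2) * a * b - \<i> * a^2 = 0"
proof
  let ?r = "(1 - \<i>) * of_real (1 + 1 / sqrt 2)"
  have "Re (1 + ?r) > 0" by (simp add: add_pos_pos)
  then have nz: "1 + ?r \<noteq> 0" by (metis less_irrefl zero_complex.sel(1))
  then show "1 / (1 + ?r) + ?r / (1 + ?r) = 1" by (simp flip: add_divide_distrib)
  show "1 / (1 + ?r) \<noteq> 0" using nz by simp
  show "(?r / (1 + ?r))^2 + (2 * \<i> - 2) * (1 / (1 + ?r)) * (?r / (1 + ?r)) - \<i> * (1 / (1 + ?r))^2 = 0"
    unfolding jacobian_factor by simp
qed

section \<open>Norms of factors with a prescribed product\<close>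

lemma two_norm_mult_le_sum_squares:
  "2 * cmod (x * y) \<le> (cmod x)^2 + (cmod y)^2"
  using sum_squares_bound[of "cmod x" "cmod y"] by (simp add: norm_mult mult.assoc)

text \<open>
  With \<open>x = \<surd>s\<close> and \<open>y = u / \<surd>s\<close> for real \<open>s > 0\<close> the norm condition becomes
  \<open>s\<^sup>2 - 2 m s + |u|\<^sup>2 = 0\<close>, whose discriminant is nonnegative because \<open>|u| \<le> m\<close>; the proof takes
  the larger root.
\<close>
lemma factor_with_norm_sum_squares:
  assumes "u \<noteq> 0" "cmod u \<le> m"
  obtains x y where "x * y = u" "(cmod x)^2 + (cmod y)^2 = 2 * m"
proof
  define s where "s = m + sqrt (m^2 - (cmod u)^2)"
  have m: "(cmod u)^2 \<le> m^2" using assms by (simp add: power_mono)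
  have "cmod u > 0" using assms by simp
  then have "m > 0" using assms(2) by linarith
  then have s: "s > 0" unfolding s_def using m by (intro add_pos_nonneg) auto
  have "(s - m)^2 = m^2 - (cmod u)^2" unfolding s_def using m by simp
  then have q: "s * s + (cmod u)^2 = 2 * m * s" by (simp add: power2_eq_square algebra_simps)
  show "of_real (sqrt s) * (u / of_real (sqrt s)) = u" using s by simp
  have "(cmod (of_real (sqrt s)))^2 + (cmod (u / of_real (sqrt s)))^2 = s + (cmod u)^2 / s"
    using s by (simp add: norm_divide power_divide)
  also have "\<dots> = 2 * m" using q s by (simp add: field_simps)
  finally show "(cmod (of_real (sqrt s)))^2 + (cmod (u / of_real (sqrt s)))^2 = 2 * m" .
qed

section \<open>The levels that contain degenerate points\<close>

theorem proposition3p1: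
  fixes t :: real
  assumes "t > 1"
  shows "(\<exists>p \<in> M3 t. degenerates_at Q3 F_tilde p) \<longleftrightarrow> t \<ge> sqrt ((2 + sqrt 2) / 3)"
proof
  assume "\<exists>p \<in> M3 t. degenerates_at Q3 F_tilde p"
  then obtain p where p: "p \<in> M3 t" "degenerates_at Q3 F_tilde p" by blast
  obtain a b c d where abcd: "p = iso_vec a b c d" by (rule iso_vec_cases)
  have Q: "a * b + c * d = 1" and N: "(cmod a)^2 + (cmod b)^2 + (cmod c)^2 + (cmod d)^2 = 2 * t"
    using p(1) by (simp_all add: abcd iso_vec_in_M3_iff)
  have "cmod (a * b) + cmod (c * d) = sqrt ((2 + sqrt 2) / 3)"
    using p(2) Q by (intro jacobian_root_norm_sum) (simp_all add: abcd degenerates_iff_jacobian_eq_0)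
  with N two_norm_mult_le_sum_squares[of a b] two_norm_mult_le_sum_squares[of c d]
  show "t \<ge> sqrt ((2 + sqrt 2) / 3)" by linarith
next
  assume t: "t \<ge> sqrt ((2 + sqrt 2) / 3)"
  obtain u v :: complex where uv: "u + v = 1" "u \<noteq> 0" "v^2 + (2 * \<i> - 2) * u * v - \<i> * u^2 = 0"
    by (rule jacobian_root_exists)
  have "cmod u \<le> t - cmod v" using jacobian_root_norm_sum[OF uv(1,3)] t by simp
  then obtain a b where ab: "a * b = u" "(cmod a)^2 + (cmod b)^2 = 2 * (t - cmod v)"
    by (rule factor_with_norm_sum_squares[OF uv(2)])
  \<comment> \<open>Splitting \<open>v\<close> evenly keeps the cost of \<open>c\<close> and \<open>d\<close> at its minimum \<open>2 |v|\<close>, so that \<open>a\<close> and \<open>b\<close>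
      have to absorb all of the remaining \<open>2 (t - |v|)\<close>.\<close>
  have v: "csqrt v * csqrt v = v" "(cmod (csqrt v))^2 = cmod v"
    by (simp_all flip: power2_eq_square norm_power)
  let ?p = "iso_vec a b (csqrt v) (csqrt v)"
  have "?p \<in> M3 t" using ab uv(1) v by (simp add: iso_vec_in_M3_iff)
  moreover have "degenerates_at Q3 F_tilde ?p"
    using ab uv v(1) by (simp add: degenerates_iff_jacobian_eq_0)
  ultimately show "\<exists>p \<in> M3 t. degenerates_at Q3 F_tilde p" by blast
qed

end
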